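(* Let $\mu$ be an upper Ahlfors $n$-dimensional measure on $\mathbb{R}^d$ and let $0<\alpha<n$. There exists a constant $C$ such that for every non-negative measurable function $f$ on $\mathbb{R}^d$ $$\mathcal{M}(\mathcal{M}_\alpha f)(x)\le C\,\mathcal{M}_\alpha f(x).$$
   Context: Fix an integer $d\ge1$ and a real number $n$ with $0<n\le d$. All cubes are cubes in $\mathbb{R}^d$ with sides parallel to the coordinate axes; $l(Q)$ is the side length of $Q$. An upper Ahlfors $n$-dimensional measure on $\mathbb{R}^d$ is a non-negative Borel measure $\mu$ with $\mu(Q)\le l(Q)^n$ for every cube $Q$. For $0\le\alpha<n$ the radial fractional maximal function is $$\mathcal{M}_\alpha f(x)=\sup_{Q\ni x}\frac{1}{l(Q)^{n-\alpha}}\int_Q|f(y)|\,d\mu(y),$$ the supremum being over all cubes $Q$ containing $x$, and $\mathcal{M}=\mathcal{M}_0$. *)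

theory Defs
  imports "HOL-Analysis.Analysis"
begin

text \<open>
  The space \<open>\<real>\<^sup>d\<close> is an arbitrary \<open>'a :: euclidean_space\<close> with \<open>d = DIM('a)\<close>; its coordinate axes
  are the directions in \<open>Basis\<close>. Cubes are taken closed and nondegenerate, and are given by their
  lower corner and side length (\<open>One\<close> is the vector with all coordinates 1). Taking open or
  half-open cubes instead yields the same measures and the same maximal functions below: enlarge a
  cube slightly and let the enlargement tend to 0.
\<close>

definition cube :: "'a::euclidean_space \<Rightarrow> real \<Rightarrow> 'a set" where
  "cube a l = cbox a (a + l *\<^sub>R One)"

definition upper_Ahlfors :: "real \<Rightarrow> 'a::euclidean_space measure \<Rightarrow> bool" where
  "upper_Ahlfors n \<mu> \<longleftrightarrow>
     sets \<mu> = sets borel \<and> (\<forall>a l. l > 0 \<longrightarrow> emeasure \<mu> (cube a l) \<le> ennreal (l powr n))"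

text \<open>
  The operator acts on \<open>[0,\<infinity>]\<close>-valued functions, since \<open>\<M>\<^sub>\<alpha> f\<close> may be infinite and the operator
  is iterated; on such functions the absolute value in the integrand is redundant.
  The function \<open>\<M>\<^sub>\<alpha> f\<close> is lower semicontinuous (again by enlarging cubes), hence Borel, so its
  \<open>nn_integral\<close> is the usual integral.
\<close>

definition frac_maximal ::
  "'a::euclidean_space measure \<Rightarrow> real \<Rightarrow> real \<Rightarrow> ('a \<Rightarrow> ennreal) \<Rightarrow> 'a \<Rightarrow> ennreal" where
  "frac_maximal \<mu> n \<alpha> f x =
     (SUP (a, l) \<in> {(a, l). l > 0 \<and> x \<in> cube a l}.
        (\<integral>\<^sup>+y\<in>cube a l. f y \<partial>\<mu>) / ennreal (l powr (n - \<alpha>)))"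

abbreviation maximal ::
  "'a::euclidean_space measure \<Rightarrow> real \<Rightarrow> ('a \<Rightarrow> ennreal) \<Rightarrow> 'a \<Rightarrow> ennreal" where
  "maximal \<mu> n \<equiv> frac_maximal \<mu> n 0"

end

theory Submission
  imports Defs
begin

text \<open>
  Fix a cube \<open>Q\<close> of side \<open>l\<close> containing \<open>x\<close>, and write \<open>3Q\<close> for the concentric cube of side \<open>3l\<close>.
  It has to be shown that \<open>\<integral>\<^sub>Q \<M>\<^sub>\<alpha> f d\<mu> \<le> C l\<^sup>n \<M>\<^sub>\<alpha> f(x)\<close>. For \<open>y \<in> Q\<close> the cubes \<open>R\<close> that contain
  \<open>y\<close> are split according to their size.

  If \<open>l(R) \<ge> l\<close>, then \<open>3R\<close> contains \<open>Q\<close>, hence \<open>x\<close>, so the average of \<open>f\<close> over \<open>R\<close> is at most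
  \<open>3\<^sup>n\<^sup>-\<^sup>\<alpha> \<M>\<^sub>\<alpha> f(x)\<close>. This is constant in \<open>y\<close>, and \<open>\<mu>(Q) \<le> l\<^sup>n\<close>.

  If \<open>l(R) < l\<close>, then \<open>R\<close> lies in the cube with centre \<open>y\<close> and radius \<open>r = 2\<^sup>-\<^sup>k l\<close>, for the \<open>k\<close> with
  \<open>r/2 < l(R) \<le> r\<close>. The supremum over these \<open>R\<close> is bounded by the \<^emph>\<open>sum\<close> over \<open>k\<close> of the averages over
  the centred cubes (lemma \<open>frac_maximal_pointwise_bound\<close>), which is a discrete form of the Riesz
  potential. Each term is linear in \<open>f\<close>, so by Tonelli, and because the centred cubes of
  radius \<open>r\<close> have measure at most \<open>(2r)\<^sup>n\<close>, its integral over \<open>Q\<close> is at most a constant times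
  \<open>r\<^sup>\<alpha> \<integral>\<^sub>3\<^sub>Q f d\<mu>\<close> (lemma \<open>integral_centred_cube_averages\<close>). As \<open>\<alpha> > 0\<close>, the sum over \<open>k\<close> is a
  convergent geometric series with value comparable to \<open>l\<^sup>\<alpha> \<integral>\<^sub>3\<^sub>Q f d\<mu>\<close>. Finally \<open>3Q\<close> is a cube that
  contains \<open>x\<close>, so this is at most a constant times \<open>l\<^sup>\<alpha> l\<^sup>n\<^sup>-\<^sup>\<alpha> \<M>\<^sub>\<alpha> f(x)\<close>. Replacing the supremum by
  a sum takes the place of a covering argument and a weak type estimate.
\<close>

section \<open>Geometry of cubes\<close>

lemma mem_cube:
  "z \<in> cube a l \<longleftrightarrow> (\<forall>b\<in>Basis. a \<bullet> b \<le> z \<bullet> b \<and> z \<bullet> b \<le> a \<bullet> b + l)"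
  by (simp add: cube_def mem_box inner_simps)

lemma cube_in_borel [measurable, simp]: "cube a l \<in> sets borel"
  by (simp add: cube_def)

definition centred_cube :: "'a::euclidean_space \<Rightarrow> real \<Rightarrow> 'a set" where
  "centred_cube y r = cube (y - r *\<^sub>R One) (2 * r)"

lemma mem_centred_cube:
  "z \<in> centred_cube y r \<longleftrightarrow> (\<forall>b\<in>Basis. \<bar>z \<bullet> b - y \<bullet> b\<bar> \<le> r)"
  by (auto simp: centred_cube_def mem_cube inner_simps abs_le_iff algebra_simps; force)

lemma centred_cube_sym: "z \<in> centred_cube y r \<longleftrightarrow> y \<in> centred_cube z r"
  by (simp add: mem_centred_cube abs_minus_commute)

lemma centred_cube_in_borel [measurable, simp]: "centred_cube a l \<in> sets borel"
  by (simp add: centred_cube_def)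

lemma cube_subset_centred_cube:
  assumes "y \<in> cube b s" "s \<le> r"
  shows "cube b s \<subseteq> centred_cube y r"
  using assms by (force simp: mem_cube mem_centred_cube abs_le_iff)

text \<open>
  The triple \<open>3Q\<close> of \<open>Q = cube a l\<close> is written as \<open>cube (a - l *\<^sub>R One) (3 * l)\<close> below.
\<close>

lemma centred_cube_subset_triple:
  assumes "y \<in> cube a l" "r \<le> l"
  shows "centred_cube y r \<subseteq> cube (a - l *\<^sub>R One) (3 * l)"
proof
  fix z assume z: "z \<in> centred_cube y r"
  show "z \<in> cube (a - l *\<^sub>R One) (3 * l)"
    unfolding mem_cube
  proof
    fix b :: 'a assume b: "b \<in> Basis"
    have "\<bar>z \<bullet> b - y \<bullet> b\<bar> \<le> r" "a \<bullet> b \<le> y \<bullet> b" "y \<bullet> b \<le> a \<bullet> b + l"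
      using z assms(1) b by (auto simp: mem_cube mem_centred_cube)
    then show "(a - l *\<^sub>R One) \<bullet> b \<le> z \<bullet> b \<and> z \<bullet> b \<le> (a - l *\<^sub>R One) \<bullet> b + 3 * l"
      using b assms(2) by (simp add: inner_simps abs_le_iff)
  qed
qed

lemma cube_subset_triple:
  assumes "l \<ge> 0"
  shows "cube a l \<subseteq> cube (a - l *\<^sub>R One) (3 * l)"
  using assms by (force simp: mem_cube inner_simps)

lemma mem_triple_of_larger_cube:
  assumes "x \<in> cube a l" "y \<in> cube a l" "y \<in> cube b s" "l \<le> s"
  shows "x \<in> cube (b - s *\<^sub>R One) (3 * s)"
  unfolding mem_cube
proof
  fix c :: 'a assume c: "c \<in> Basis"
  have "a \<bullet> c \<le> x \<bullet> c" "x \<bullet> c \<le> a \<bullet> c + l" "a \<bullet> c \<le> y \<bullet> c" "y \<bullet> c \<le> a \<bullet> c + l"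
    "b \<bullet> c \<le> y \<bullet> c" "y \<bullet> c \<le> b \<bullet> c + s"
    using assms c by (auto simp: mem_cube)
  then show "(b - s *\<^sub>R One) \<bullet> c \<le> x \<bullet> c \<and> x \<bullet> c \<le> (b - s *\<^sub>R One) \<bullet> c + 3 * s"
    using c assms(4) by (simp add: inner_simps)
qed

section \<open>Pointwise domination by a dyadic Riesz potential\<close>

lemma set_nn_integral_mono_set:
  assumes "A \<subseteq> B"
  shows "(\<integral>\<^sup>+y\<in>A. f y \<partial>\<mu>) \<le> (\<integral>\<^sup>+y\<in>B. f y \<partial>\<mu>)"
  using assms by (intro nn_integral_mono) (auto simp: indicator_def)

lemma integral_cube_le_frac_maximal:
  assumes "l > 0" "x \<in> cube a l"
  shows "(\<integral>\<^sup>+y\<in>cube a l. f y \<partial>\<mu>) \<le> ennreal (l powr (n - \<alpha>)) * frac_maximal \<mu> n \<alpha> f x"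
proof -
  let ?c = "ennreal (l powr (n - \<alpha>))" and ?I = "\<integral>\<^sup>+y\<in>cube a l. f y \<partial>\<mu>"
  have "?I / ?c \<le> frac_maximal \<mu> n \<alpha> f x"
    unfolding frac_maximal_def
    by (rule SUP_upper2[of "(a, l)"]) (use assms in auto)
  then have "?c * (?I / ?c) \<le> ?c * frac_maximal \<mu> n \<alpha> f x"
    by (rule mult_left_mono) simp
  moreover have "?c * (?I / ?c) = ?I"
    using assms(1) by (simp add: ennreal_times_divide mult.commute[of ?c] mult_divide_eq_ennreal)
  ultimately show ?thesis by simp
qed

text \<open>
  The scale of \<open>s\<close> is the last \<open>k\<close> before \<open>l / 2 ^ k\<close> drops below \<open>s\<close>.
\<close>

lemma dyadic_scale:
  fixes s l :: real
  assumes "0 < s" "s \<le> l"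
  obtains k :: nat where "l / 2 ^ k < 2 * s" "s \<le> l / 2 ^ k"
proof -
  have "\<exists>k::nat. l / s < 2 ^ k"
    by (rule real_arch_pow) simp
  then have "\<exists>k::nat. l / 2 ^ k < s"
    using assms by (simp add: field_simps)
  then have "\<exists>k::nat. l / 2 ^ k < s \<and> (\<forall>j<k. \<not> l / 2 ^ j < s)"
    by (rule exists_least_iff[THEN iffD1])
  then obtain m :: nat where m: "l / 2 ^ m < s" "\<forall>j<m. \<not> l / 2 ^ j < s" by blast
  have "m \<noteq> 0" using m(1) assms by (intro notI) simp
  then obtain k where k: "m = Suc k" by (cases m) auto
  show ?thesis
    by (rule that[of k]) (use m k in \<open>auto simp: field_simps not_less\<close>)
qed

text \<open>
  The first summand bounds the averages over cubes of side at least \<open>l\<close>, whose triples contain \<open>x\<close>.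
  The series bounds those over smaller cubes: if \<open>r/2 < s \<le> r\<close> with \<open>r = l / 2 ^ k\<close>, then a cube of
  side \<open>s\<close> containing \<open>y\<close> lies in the centred cube of radius \<open>r\<close>, and the normalising factor
  \<open>(1/s)\<^sup>n\<^sup>-\<^sup>\<alpha>\<close> is at most \<open>(2/r)\<^sup>n\<^sup>-\<^sup>\<alpha>\<close>, so the single term of index \<open>k\<close> suffices.
\<close>

lemma frac_maximal_pointwise_bound:
  fixes \<mu> :: "'a::euclidean_space measure"
  assumes "l > 0" "x \<in> cube a l" "y \<in> cube a l" "\<alpha> \<le> n"
  shows "frac_maximal \<mu> n \<alpha> f y \<le>
     ennreal (3 powr (n - \<alpha>)) * frac_maximal \<mu> n \<alpha> f x +
     (\<Sum>k. ennreal ((2 / (l / 2 ^ k)) powr (n - \<alpha>)) * (\<integral>\<^sup>+z\<in>centred_cube y (l / 2 ^ k). f z \<partial>\<mu>))"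
    (is "_ \<le> ?A + (\<Sum>k. ?t k)")
  unfolding frac_maximal_def[of \<mu> n \<alpha> f y]
proof (rule SUP_least, clarify)
  fix b :: 'a and s :: real
  assume s: "s > 0" and y: "y \<in> cube b s"
  let ?I = "\<integral>\<^sup>+z\<in>cube b s. f z \<partial>\<mu>"
  show "?I / ennreal (s powr (n - \<alpha>)) \<le> ?A + (\<Sum>k. ?t k)"
  proof (cases "l \<le> s")
    case True
    have "?I \<le> (\<integral>\<^sup>+z\<in>cube (b - s *\<^sub>R One) (3 * s). f z \<partial>\<mu>)"
      using s by (intro set_nn_integral_mono_set cube_subset_triple) simp
    also have "\<dots> \<le> ennreal ((3 * s) powr (n - \<alpha>)) * frac_maximal \<mu> n \<alpha> f x"
      using s by (intro integral_cube_le_frac_maximal mem_triple_of_larger_cube[OF assms(2,3) y True]) simp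
    also have "\<dots> = ?A * ennreal (s powr (n - \<alpha>))"
      using s by (simp add: powr_mult ennreal_mult' mult_ac)
    finally have "?I / ennreal (s powr (n - \<alpha>)) \<le> ?A"
      using s by (simp add: divide_le_posI_ennreal mult.commute)
    then show ?thesis by (simp add: add_increasing2)
  next
    case False
    then obtain k :: nat where k: "l / 2 ^ k < 2 * s" "s \<le> l / 2 ^ k"
      using dyadic_scale[of s l] s by (metis less_le not_less)
    let ?r = "l / 2 ^ k"
    have r: "?r > 0" using assms by simp
    have "inverse (s powr (n - \<alpha>)) = (1 / s) powr (n - \<alpha>)"
      using s by (simp add: powr_divide inverse_eq_divide)
    also have "1 / s = 2 / (2 * s)" by simp
    also have "(2 / (2 * s)) powr (n - \<alpha>) \<le> (2 / ?r) powr (n - \<alpha>)"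
    proof (rule powr_mono2)
      show "2 / (2 * s) \<le> 2 / ?r"
        using k(1) s r by (intro divide_left_mono mult_pos_pos) simp_all
    qed (use s assms(4) in auto)
    finally have "inverse (s powr (n - \<alpha>)) \<le> (2 / ?r) powr (n - \<alpha>)" .
    then have "?I / ennreal (s powr (n - \<alpha>)) \<le> ?I * ennreal ((2 / ?r) powr (n - \<alpha>))"
      using s by (simp add: divide_ennreal_def inverse_ennreal mult_left_mono)
    also have "\<dots> \<le> ?t k"
      using set_nn_integral_mono_set[OF cube_subset_centred_cube[OF y k(2)], of \<mu> f]
      by (subst mult.commute) (rule mult_left_mono, simp_all)
    also have "\<dots> \<le> (\<Sum>k. ?t k)"
      using sum_le_suminf[of ?t "{k}"] by simp
    finally show ?thesis by (simp add: add_increasing)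
  qed
qed

section \<open>Integration of the dyadic series over a cube\<close>

lemma upper_Ahlfors_sigma_finite:
  fixes \<mu> :: "'a::euclidean_space measure"
  assumes "upper_Ahlfors n \<mu>"
  shows "sigma_finite_measure \<mu>"
proof
  have [measurable_cong, simp]: "sets \<mu> = sets borel" using assms by (simp add: upper_Ahlfors_def)
  have sp: "space \<mu> = UNIV" using sets_eq_imp_space_eq[of \<mu> borel] by simp
  let ?B = "\<lambda>i::nat. centred_cube (0::'a) (real (Suc i))"
  have fin: "emeasure \<mu> (?B i) \<noteq> \<infinity>" for i
  proof -
    have "emeasure \<mu> (?B i) \<le> ennreal ((2 * real (Suc i)) powr n)"
      using assms unfolding centred_cube_def upper_Ahlfors_def
      by (metis of_nat_0_less_iff zero_less_Suc mult_pos_pos zero_less_numeral)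
    then show ?thesis by (metis ennreal_less_top infinity_ennreal_def leD)
  qed
  have "z \<in> \<Union> (range ?B)" for z
  proof -
    obtain i :: nat where i: "norm z \<le> real i" using real_arch_simple by blast
    have "\<bar>z \<bullet> b\<bar> \<le> real (Suc i)" if "b \<in> Basis" for b
      using Basis_le_norm[OF that, of z] i by simp
    then have "z \<in> ?B i" by (simp add: mem_centred_cube)
    then show ?thesis by blast
  qed
  then have "\<Union> (range ?B) = space \<mu>" using sp by auto
  then show "\<exists>A. countable A \<and> A \<subseteq> sets \<mu> \<and> \<Union> A = space \<mu> \<and> (\<forall>a\<in>A. emeasure \<mu> a \<noteq> \<infinity>)"
    using fin by (intro exI[of _ "range ?B"]) auto
qed

lemma measurable_centred_cube_kernel:
  fixes f :: "'a::euclidean_space \<Rightarrow> ennreal"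
  assumes "sets \<mu> = sets borel" and [measurable]: "f \<in> borel_measurable borel"
  shows "(\<lambda>(y, z). f z * indicator (centred_cube y r) z) \<in> borel_measurable (\<mu> \<Otimes>\<^sub>M \<mu>)"
proof -
  have [measurable_cong]: "sets \<mu> = sets borel" by fact
  have "(\<lambda>p::'a \<times> 'a. f (snd p) * (if \<forall>b\<in>Basis. \<bar>snd p \<bullet> b - fst p \<bullet> b\<bar> \<le> r then 1 else 0))
     \<in> borel_measurable (\<mu> \<Otimes>\<^sub>M \<mu>)"
    by measurable
  also have "(\<lambda>p::'a \<times> 'a. f (snd p) * (if \<forall>b\<in>Basis. \<bar>snd p \<bullet> b - fst p \<bullet> b\<bar> \<le> r then 1 else 0))
     = (\<lambda>(y, z). f z * indicator (centred_cube y r) z)"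
    by (auto simp: fun_eq_iff indicator_def mem_centred_cube)
  finally show ?thesis .
qed

lemma measurable_centred_cube_integral:
  fixes f :: "'a::euclidean_space \<Rightarrow> ennreal"
  assumes "upper_Ahlfors n \<mu>" "f \<in> borel_measurable borel"
  shows "(\<lambda>y. \<integral>\<^sup>+z\<in>centred_cube y r. f z \<partial>\<mu>) \<in> borel_measurable \<mu>"
proof -
  interpret sigma_finite_measure \<mu> by (rule upper_Ahlfors_sigma_finite) fact
  show ?thesis
    using measurable_centred_cube_kernel[of \<mu> f r] assms
    by (intro borel_measurable_nn_integral) (simp_all add: upper_Ahlfors_def)
qed

text \<open>
  By Tonelli the left-hand side is the integral of \<open>f(z) \<mu>({y \<in> Q. y \<in> Q(z,r)})\<close>, where \<open>Q(z,r)\<close> is the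
  centred cube; only \<open>z \<in> 3Q\<close> contribute.
\<close>

lemma integral_centred_cube_averages:
  fixes f :: "'a::euclidean_space \<Rightarrow> ennreal"
  assumes A: "upper_Ahlfors n \<mu>" and f [measurable]: "f \<in> borel_measurable borel"
    and r: "0 < r" "r \<le> l"
  shows "(\<integral>\<^sup>+y\<in>cube a l. (\<integral>\<^sup>+z\<in>centred_cube y r. f z \<partial>\<mu>) \<partial>\<mu>)
     \<le> ennreal ((2 * r) powr n) * (\<integral>\<^sup>+z\<in>cube (a - l *\<^sub>R One) (3 * l). f z \<partial>\<mu>)"
proof -
  interpret sigma_finite_measure \<mu> by (rule upper_Ahlfors_sigma_finite) fact
  interpret P: pair_sigma_finite \<mu> \<mu> ..
  have sets [measurable_cong, simp]: "sets \<mu> = sets borel" using A by (simp add: upper_Ahlfors_def)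
  let ?Q = "cube a l" and ?T = "cube (a - l *\<^sub>R One) (3 * l)"
  have ker [measurable]: "(\<lambda>(y, z). f z * indicator (centred_cube y r) z) \<in> borel_measurable (\<mu> \<Otimes>\<^sub>M \<mu>)"
    by (rule measurable_centred_cube_kernel) simp_all
  have "(\<integral>\<^sup>+y\<in>?Q. (\<integral>\<^sup>+z\<in>centred_cube y r. f z \<partial>\<mu>) \<partial>\<mu>)
      = (\<integral>\<^sup>+y. (\<integral>\<^sup>+z. f z * indicator (centred_cube y r) z * indicator ?Q y \<partial>\<mu>) \<partial>\<mu>)"
    by (intro nn_integral_cong nn_integral_multc[symmetric]) measurable
  also have "\<dots> = (\<integral>\<^sup>+z. (\<integral>\<^sup>+y. f z * indicator (centred_cube y r) z * indicator ?Q y \<partial>\<mu>) \<partial>\<mu>)"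
  proof (rule P.Fubini'[symmetric])
    have "(\<lambda>p. (case p of (y, z) \<Rightarrow> f z * indicator (centred_cube y r) z) * indicator ?Q (fst p))
        \<in> borel_measurable (\<mu> \<Otimes>\<^sub>M \<mu>)"
      by measurable
    then show "(\<lambda>(y, z). f z * indicator (centred_cube y r) z * indicator ?Q y)
        \<in> borel_measurable (\<mu> \<Otimes>\<^sub>M \<mu>)"
      by (simp add: split_beta')
  qed
  also have "\<dots> \<le> (\<integral>\<^sup>+z. (f z * indicator ?T z) * ennreal ((2 * r) powr n) \<partial>\<mu>)"
  proof (rule nn_integral_mono)
    fix z :: 'a
    have "(\<integral>\<^sup>+y. f z * indicator (centred_cube y r) z * indicator ?Q y \<partial>\<mu>)
       \<le> (\<integral>\<^sup>+y. (f z * indicator ?T z) * indicator (centred_cube z r) y \<partial>\<mu>)"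
      using centred_cube_subset_triple[of _ a l r] r(2)
      by (intro nn_integral_mono) (auto simp: indicator_def centred_cube_sym[of _ z])
    also have "\<dots> = (f z * indicator ?T z) * emeasure \<mu> (centred_cube z r)"
      by (rule nn_integral_cmult_indicator) simp
    also have "\<dots> \<le> (f z * indicator ?T z) * ennreal ((2 * r) powr n)"
      using A r(1) by (intro mult_left_mono) (auto simp: upper_Ahlfors_def centred_cube_def)
    finally show "(\<integral>\<^sup>+y. f z * indicator (centred_cube y r) z * indicator ?Q y \<partial>\<mu>)
       \<le> (f z * indicator ?T z) * ennreal ((2 * r) powr n)" .
  qed
  also have "\<dots> = (\<integral>\<^sup>+z\<in>?T. f z \<partial>\<mu>) * ennreal ((2 * r) powr n)"
    by (rule nn_integral_multc) measurable
  finally show ?thesis by (simp add: mult.commute)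
qed

lemma dyadic_powr_sums:
  fixes l \<alpha> :: real
  assumes "0 < l" "0 < \<alpha>"
  shows "(\<lambda>k::nat. (l / 2 ^ k) powr \<alpha>) sums (l powr \<alpha> / (1 - 2 powr (-\<alpha>)))"
proof -
  have "2 powr (-\<alpha>) < 1" using assms by (simp add: powr_less_one)
  then have "(\<lambda>k::nat. l powr \<alpha> * (2 powr (-\<alpha>)) ^ k) sums (l powr \<alpha> * (1 / (1 - 2 powr (-\<alpha>))))"
    by (intro sums_mult geometric_sums) simp
  moreover have "l powr \<alpha> * (2 powr (-\<alpha>)) ^ k = (l / 2 ^ k) powr \<alpha>" for k :: nat
  proof -
    have "(2 powr (-\<alpha>)) ^ k = (2 powr (- real k)) powr \<alpha>"
      by (simp add: powr_power powr_powr mult.commute)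
    also have "2 powr (- real k) = 1 / 2 ^ k"
      by (simp add: powr_minus powr_realpow inverse_eq_divide)
    finally show ?thesis using assms by (simp add: powr_divide)
  qed
  ultimately show ?thesis by simp
qed

lemma integral_dyadic_series:
  fixes f :: "'a::euclidean_space \<Rightarrow> ennreal"
  assumes A: "upper_Ahlfors n \<mu>" and f [measurable]: "f \<in> borel_measurable borel"
    and l: "0 < l" and \<alpha>: "0 < \<alpha>"
  shows "(\<integral>\<^sup>+y\<in>cube a l. (\<Sum>k. ennreal ((2 / (l / 2 ^ k)) powr (n - \<alpha>)) *
             (\<integral>\<^sup>+z\<in>centred_cube y (l / 2 ^ k). f z \<partial>\<mu>)) \<partial>\<mu>)
     \<le> ennreal (2 powr (2 * n - \<alpha>) * (l powr \<alpha> / (1 - 2 powr (-\<alpha>)))) *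
        (\<integral>\<^sup>+z\<in>cube (a - l *\<^sub>R One) (3 * l). f z \<partial>\<mu>)"
    (is "?L \<le> _ * ?I")
proof -
  have sets [measurable_cong, simp]: "sets \<mu> = sets borel" using A by (simp add: upper_Ahlfors_def)
  note measurable_centred_cube_integral[OF A f, measurable]
  let ?r = "\<lambda>k::nat. l / 2 ^ k"
  let ?c = "\<lambda>k. ennreal ((2 / ?r k) powr (n - \<alpha>))"
  let ?F = "\<lambda>k y. \<integral>\<^sup>+z\<in>centred_cube y (?r k). f z \<partial>\<mu>"
  have "?L = (\<integral>\<^sup>+y. (\<Sum>k. ?c k * (?F k y * indicator (cube a l) y)) \<partial>\<mu>)"
    by (simp flip: ennreal_suminf_multc add: mult.assoc)
  also have "\<dots> = (\<Sum>k. \<integral>\<^sup>+y. ?c k * (?F k y * indicator (cube a l) y) \<partial>\<mu>)"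
    by (rule nn_integral_suminf) measurable
  also have "\<dots> = (\<Sum>k. ?c k * (\<integral>\<^sup>+y\<in>cube a l. ?F k y \<partial>\<mu>))"
    by (intro suminf_cong nn_integral_cmult) measurable
  also have "\<dots> \<le> (\<Sum>k. ennreal (2 powr (2 * n - \<alpha>) * (?r k powr \<alpha>)) * ?I)"
  proof (intro suminf_le allI)
    fix k :: nat
    have r: "0 < ?r k" "?r k \<le> l" using l by (auto simp: field_simps)
    have "?c k * (\<integral>\<^sup>+y\<in>cube a l. ?F k y \<partial>\<mu>) \<le> ?c k * (ennreal ((2 * ?r k) powr n) * ?I)"
      by (intro mult_left_mono integral_centred_cube_averages[OF A f r]) simp
    also have "\<dots> = ennreal ((2 / ?r k) powr (n - \<alpha>) * (2 * ?r k) powr n) * ?I"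
      by (simp add: ennreal_mult' mult.assoc)
    also have "(2 / ?r k) powr (n - \<alpha>) * (2 * ?r k) powr n
        = (2 powr (n - \<alpha>) * 2 powr n) * (?r k powr n / ?r k powr (n - \<alpha>))"
      using r(1) powr_divide[of 2 "?r k" "n - \<alpha>"] powr_mult[of 2 "?r k" n]
      by (simp only: times_divide_eq_left times_divide_eq_right mult_ac)
    also have "\<dots> = 2 powr (2 * n - \<alpha>) * (?r k powr \<alpha>)"
      by (simp only: powr_add[symmetric] powr_diff[symmetric]) (simp add: algebra_simps)
    finally show "?c k * (\<integral>\<^sup>+y\<in>cube a l. ?F k y \<partial>\<mu>) \<le> ennreal (2 powr (2 * n - \<alpha>) * (?r k powr \<alpha>)) * ?I" .
  qed simp_all
  also have "\<dots> = (\<Sum>k. ennreal (2 powr (2 * n - \<alpha>) * (?r k powr \<alpha>))) * ?I"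
    by (rule ennreal_suminf_multc)
  also have "(\<Sum>k. ennreal (2 powr (2 * n - \<alpha>) * (?r k powr \<alpha>)))
      = ennreal (2 powr (2 * n - \<alpha>) * (l powr \<alpha> / (1 - 2 powr (-\<alpha>))))"
    by (intro suminf_ennreal_eq sums_mult dyadic_powr_sums l \<alpha>) simp
  finally show ?thesis .
qed

section \<open>The maximal function of the fractional maximal function\<close>

text \<open>
  The pointwise bound is integrated over \<open>Q\<close>; its summands are measurable functions of \<open>y\<close>, so the
  integral of the bound splits into two parts. Both have size \<open>l\<^sup>n\<close>: the first because \<open>\<mu>(Q) \<le> l\<^sup>n\<close>, the second because \<open>l\<^sup>\<alpha>\<close> from the series meets
  \<open>(3l)\<^sup>n\<^sup>-\<^sup>\<alpha>\<close> from the integral of \<open>f\<close> over \<open>3Q\<close>.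
\<close>

lemma integral_frac_maximal_cube:
  fixes f :: "'a::euclidean_space \<Rightarrow> ennreal"
  assumes A: "upper_Ahlfors n \<mu>" and f [measurable]: "f \<in> borel_measurable borel"
    and l: "0 < l" and \<alpha>: "0 < \<alpha>" "\<alpha> \<le> n" and x: "x \<in> cube a l"
  shows "(\<integral>\<^sup>+y\<in>cube a l. frac_maximal \<mu> n \<alpha> f y \<partial>\<mu>)
    \<le> ennreal (3 powr (n - \<alpha>) * (1 + 2 powr (2 * n - \<alpha>) / (1 - 2 powr (-\<alpha>)))) *
       frac_maximal \<mu> n \<alpha> f x * ennreal (l powr n)"
proof -
  have sets [measurable_cong, simp]: "sets \<mu> = sets borel" using A by (simp add: upper_Ahlfors_def)
  note measurable_centred_cube_integral[OF A f, measurable]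
  let ?M = "frac_maximal \<mu> n \<alpha> f x" and ?Q = "cube a l"
  let ?K = "3 powr (n - \<alpha>)" and ?D = "2 powr (2 * n - \<alpha>) / (1 - 2 powr (-\<alpha>))"
  let ?S = "\<lambda>y. \<Sum>k. ennreal ((2 / (l / 2 ^ k)) powr (n - \<alpha>)) *
             (\<integral>\<^sup>+z\<in>centred_cube y (l / 2 ^ k). f z \<partial>\<mu>)"
  have D: "?D \<ge> 0" using \<alpha> by (simp add: powr_le_one_le powr_less_one less_imp_le)
  have "(\<integral>\<^sup>+y\<in>?Q. frac_maximal \<mu> n \<alpha> f y \<partial>\<mu>)
     \<le> (\<integral>\<^sup>+y. ennreal ?K * ?M * indicator ?Q y + ?S y * indicator ?Q y \<partial>\<mu>)"
    using frac_maximal_pointwise_bound[OF l x _ \<alpha>(2), of _ \<mu> f]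
    by (intro nn_integral_mono) (auto simp: indicator_def)
  also have "\<dots> = (\<integral>\<^sup>+y. ennreal ?K * ?M * indicator ?Q y \<partial>\<mu>) + (\<integral>\<^sup>+y\<in>?Q. ?S y \<partial>\<mu>)"
    by (rule nn_integral_add) measurable
  also have "(\<integral>\<^sup>+y. ennreal ?K * ?M * indicator ?Q y \<partial>\<mu>) = ennreal ?K * ?M * emeasure \<mu> ?Q"
    by (rule nn_integral_cmult_indicator) simp
  also have "\<dots> \<le> ennreal ?K * ?M * ennreal (l powr n)"
    using A l by (intro mult_left_mono) (auto simp: upper_Ahlfors_def)
  also have "(\<integral>\<^sup>+y\<in>?Q. ?S y \<partial>\<mu>) \<le> ennreal (?K * ?D) * ?M * ennreal (l powr n)"
  proof -
    have "(\<integral>\<^sup>+y\<in>?Q. ?S y \<partial>\<mu>) \<le> ennreal (2 powr (2 * n - \<alpha>) * (l powr \<alpha> / (1 - 2 powr (-\<alpha>)))) *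
        (\<integral>\<^sup>+z\<in>cube (a - l *\<^sub>R One) (3 * l). f z \<partial>\<mu>)"
      by (rule integral_dyadic_series[OF A f l \<alpha>(1)])
    also have "\<dots> \<le> ennreal (?D * l powr \<alpha>) * (ennreal ((3 * l) powr (n - \<alpha>)) * ?M)"
      using l x cube_subset_triple[of l a]
      by (intro mult_mono integral_cube_le_frac_maximal) auto
    also have "\<dots> = ennreal (?D * l powr \<alpha> * (3 * l) powr (n - \<alpha>)) * ?M"
      unfolding ennreal_mult''[OF powr_ge_zero] by (simp only: mult.assoc)
    also have "?D * l powr \<alpha> * (3 * l) powr (n - \<alpha>) = ?K * ?D * l powr n"
      using l by (simp add: powr_mult powr_diff mult_ac)
    also have "ennreal (?K * ?D * l powr n) * ?M = ennreal (?K * ?D) * ?M * ennreal (l powr n)"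
      unfolding ennreal_mult''[OF powr_ge_zero] by (simp only: mult_ac)
    finally show ?thesis .
  qed
  also have "ennreal ?K * ?M * ennreal (l powr n) + ennreal (?K * ?D) * ?M * ennreal (l powr n)
     = (ennreal ?K + ennreal (?K * ?D)) * ?M * ennreal (l powr n)"
    by (simp add: distrib_right)
  also have "ennreal ?K + ennreal (?K * ?D) = ennreal (?K * (1 + ?D))"
    by (simp only: distrib_left mult_1_right ennreal_plus mult_nonneg_nonneg powr_ge_zero D)
  finally show ?thesis by (auto simp: add_mono)
qed

theorem theorem1p10:
  fixes \<mu> :: "'a::euclidean_space measure" and n \<alpha> :: real
  assumes "0 < n" and "n \<le> real DIM('a)"
    and "upper_Ahlfors n \<mu>"
    and "0 < \<alpha>" and "\<alpha> < n"
  shows "\<exists>C::real. C \<ge> 0 \<and>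
           (\<forall>f :: 'a \<Rightarrow> ennreal. f \<in> borel_measurable borel \<longrightarrow>
              (\<forall>x. maximal \<mu> n (frac_maximal \<mu> n \<alpha> f) x \<le> ennreal C * frac_maximal \<mu> n \<alpha> f x))"
proof -
  let ?C = "3 powr (n - \<alpha>) * (1 + 2 powr (2 * n - \<alpha>) / (1 - 2 powr (-\<alpha>)))"
  have C: "?C \<ge> 0"
    using assms by (simp add: powr_less_one less_imp_le)
  have "maximal \<mu> n (frac_maximal \<mu> n \<alpha> f) x \<le> ennreal ?C * frac_maximal \<mu> n \<alpha> f x"
    if f: "f \<in> borel_measurable borel" for f :: "'a \<Rightarrow> ennreal" and x
    unfolding frac_maximal_def[of \<mu> n 0]
  proof (rule SUP_least, clarify)
    fix a :: 'a and l :: real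
    assume l: "l > 0" and x: "x \<in> cube a l"
    show "(\<integral>\<^sup>+y\<in>cube a l. frac_maximal \<mu> n \<alpha> f y \<partial>\<mu>) / ennreal (l powr (n - 0))
        \<le> ennreal ?C * frac_maximal \<mu> n \<alpha> f x"
      using integral_frac_maximal_cube[OF assms(3) f l assms(4) less_imp_le[OF assms(5)] x] l
      by (simp add: divide_le_posI_ennreal mult.commute)
  qed
  then show ?thesis using C by blast
qed

end
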